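(* Let $N\geq 1$ be an integer, let $\Omega$ be a compact subset of $\mathbb{P}^N(\mathbb{R})$ which supports a measure $\hat{\mu}$ that is $\delta$-Ahlfors regular and projectively absolutely $\eta$-decaying, for some $\delta,\eta>0$, and let $\psi:\mathbb{N}\to\mathbb{R}_{>0}$ be a non-increasing function. If the sum $$\sum_{m=1}^{\infty} m^{\frac{N+1}{N}\eta-1}\,\psi(m)^{\eta}$$ converges, then for $\hat{\mu}$-almost every $\hat{\mathbf{x}}\in\mathbb{P}^N(\mathbb{R})\cap\Omega$ the inequality $$\delta_\infty(\hat{\mathbf{x}},\hat{\mathbf{q}})<\psi(H(\hat{\mathbf{q}}))$$ has only finitely many solutions $\hat{\mathbf{q}}\in\mathbb{P}^N(\mathbb{Q})$.
   Context: Let $\phi:\mathbb{R}^{N+1}\setminus\{\mathbf{0}\}\to\mathbb{P}^N(\mathbb{R})$ be the quotient map sending $\mathbf{x}=(x_0,\ldots,x_N)$ to the point $\hat{\mathbf{x}}$ with homogeneous coordinates $[x_0,\ldots,x_N]$. The space $\mathbb{P}^N(\mathbb{R})$ carries the metric $$\delta_\infty(\hat{\mathbf{x}},\hat{\mathbf{y}})=\frac{|\mathbf{x}\wedge\mathbf{y}|}{|\mathbf{x}|\,|\mathbf{y}|},\qquad \hat{\mathbf{x}}=\phi(\mathbf{x}),\ \hat{\mathbf{y}}=\phi(\mathbf{y}),$$ where $|\cdot|$ is the Euclidean norm and $\wedge$ is the exterior product; equivalently, $\delta_\infty(\hat{\mathbf{x}},\hat{\mathbf{y}})$ is the sine of the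 smallest angle between the lines spanned by $\mathbf{x}$ and $\mathbf{y}$, so $|\mathbf{x}\wedge\mathbf{y}|^2=|\mathbf{x}|^2|\mathbf{y}|^2-(\mathbf{x}\cdot\mathbf{y})^2$. $\mathbb{N}=\{1,2,3,\ldots\}$. $\mathbb{P}^N(\mathbb{Q})\subset\mathbb{P}^N(\mathbb{R})$ denotes the set of points having a representative in $\mathbb{Q}^{N+1}\setminus\{\mathbf{0}\}$. The height of $\hat{\mathbf{q}}\in\mathbb{P}^N(\mathbb{Q})$ is $H(\hat{\mathbf{q}})=\max(|q'_1|,\ldots,|q'_{N+1}|)$, where $(q'_1,\ldots,q'_{N+1})$ is a representative of $\hat{\mathbf{q}}$ consisting of integers, not all zero, with $\gcd(q'_1,\ldots,q'_{N+1})=1$. Measure conditions. All measures considered are locally finite Borel measures supported on the compact set $\Omega\subseteq\mathbb{P}^N(\mathbb{R})$. Write $\hat{B}(\hat{\mathbf{x}},r)$ for the closed ball in $(\mathbb{P}^N(\mathbb{R}),\delta_\infty)$ with centre $\hat{\mathbf{x}}\in\Omega$ and radius $r>0$; only radii $r\le\sin 1$ are considered. (i) A measure $m$ is $\delta$-Ahlfors regular ($\delta>0$) if there exist $r_0>0$ and constants $0<a\le 1\le b$ such that $a r^{\delta}\le m(\hat{B}(\hat{\mathbf{x}},r))\le b r^{\delta}$ for all $\hat{\mathbf{x}}\in\Omega$ and all $0<r<r_0$. (ii) A projective hyperplane is a set $\mathcal{P}=\phi(\mathcal{L}\setminus\{\mathbf{0}\})$ where $\mathcal{L}$ is an $N$-dimensional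 linear subspace of $\mathbb{R}^{N+1}$. For $\epsilon>0$ put $\mathcal{P}^{(\epsilon)}=\{\hat{\mathbf{x}}\in\mathbb{P}^N(\mathbb{R}):\inf_{\hat{\mathbf{y}}\in\mathcal{P}}\delta_\infty(\hat{\mathbf{x}},\hat{\mathbf{y}})<\epsilon\}$. A measure $m$ is projectively absolutely $\eta$-decaying ($\eta>0$) if there exist constants $c>0$ and $r_0>0$ such that for every projective hyperplane $\mathcal{P}$, every $\epsilon>0$, every $\hat{\mathbf{x}}\in\Omega$ and every $0<r<r_0$, $$m\big(\hat{B}(\hat{\mathbf{x}},r)\cap\mathcal{P}^{(\epsilon)}\big)\le c\left(\frac{\epsilon}{r}\right)^{\eta}m\big(\hat{B}(\hat{\mathbf{x}},r)\big).$$ *)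

theory Defs
  imports "HOL-Analysis.Analysis"
begin

text \<open>
  Throughout, \<^term>\<open>CARD('n)\<close> plays the role of $N+1$, so that the type \<open>'n proj\<close> below
  is the $N$-dimensional real projective space with its metric $\delta_\infty$.
\<close>

section \<open>Exterior product of two vectors\<close>

text \<open>
  The bivector $x \wedge y$ is represented by the alternating matrix of its Pluecker
  coordinates.
\<close>

definition wedge :: "real ^ 'n \<Rightarrow> real ^ 'n \<Rightarrow> real ^ 'n ^ 'n" where
  "wedge x y = (\<chi> i j. x $ i * y $ j - x $ j * y $ i)"

definition wedge_norm :: "real ^ 'n \<Rightarrow> real ^ 'n \<Rightarrow> real" where
  "wedge_norm x y = sqrt ((\<Sum>i\<in>UNIV. \<Sum>j\<in>UNIV. (wedge x y $ i $ j)\<^sup>2) / 2)"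

lemma wedge_norm_power2:
  fixes x y :: "real ^ 'n"
  shows "(wedge_norm x y)\<^sup>2 = (norm x)\<^sup>2 * (norm y)\<^sup>2 - (x \<bullet> y)\<^sup>2"
proof -
  have n2: "(norm z)\<^sup>2 = (\<Sum>i\<in>UNIV. (z $ i)\<^sup>2)" for z :: "real ^ 'n"
    unfolding power2_norm_eq_inner inner_vec_def by (simp add: power2_eq_square)
  have "(\<Sum>i\<in>UNIV. \<Sum>j\<in>UNIV. (wedge x y $ i $ j)\<^sup>2) =
     (\<Sum>i\<in>UNIV. \<Sum>j\<in>UNIV. (x $ i)\<^sup>2 * (y $ j)\<^sup>2 + (y $ i)\<^sup>2 * (x $ j)\<^sup>2
        - 2 * ((x $ i * y $ i) * (x $ j * y $ j)))"
    by (simp add: wedge_def power2_diff power_mult_distrib algebra_simps)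
  also have "\<dots> = 2 * ((\<Sum>i\<in>UNIV. \<Sum>j\<in>UNIV. (x $ i)\<^sup>2 * (y $ j)\<^sup>2)
      - (\<Sum>i\<in>UNIV. \<Sum>j\<in>UNIV. (x $ i * y $ i) * (x $ j * y $ j)))"
    using sum.swap[of "\<lambda>i j. (y $ i)\<^sup>2 * (x $ j)\<^sup>2" UNIV UNIV]
    by (simp add: sum.distrib sum_subtractf sum_distrib_left mult.commute)
  also have "\<dots> = 2 * ((norm x)\<^sup>2 * (norm y)\<^sup>2 - (x \<bullet> y)\<^sup>2)"
    by (simp add: n2 inner_vec_def power2_eq_square[of "sum _ _"] sum_product)
  finally have eq: "(\<Sum>i\<in>UNIV. \<Sum>j\<in>UNIV. (wedge x y $ i $ j)\<^sup>2) =
      2 * ((norm x)\<^sup>2 * (norm y)\<^sup>2 - (x \<bullet> y)\<^sup>2)" .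
  have "0 \<le> (\<Sum>i\<in>UNIV. \<Sum>j\<in>UNIV. (wedge x y $ i $ j)\<^sup>2)"
    by (intro sum_nonneg) auto
  then show ?thesis
    by (simp add: wedge_norm_def eq)
qed

lemma wedge_norm_nonneg: "0 \<le> wedge_norm x y"
  by (auto simp: wedge_norm_def intro!: sum_nonneg)

lemma wedge_norm_eq: "wedge_norm x y = sqrt ((norm x)\<^sup>2 * (norm y)\<^sup>2 - (x \<bullet> y)\<^sup>2)"
  by (metis wedge_norm_power2 wedge_norm_nonneg real_sqrt_unique)

lemma wedge_norm_commute: "wedge_norm x y = wedge_norm y x"
  by (simp add: wedge_norm_eq inner_commute mult.commute)

lemma wedge_norm_scaleR: "wedge_norm (c *\<^sub>R x) (d *\<^sub>R y) = \<bar>c\<bar> * \<bar>d\<bar> * wedge_norm x y"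
proof -
  have "(norm (c *\<^sub>R x))\<^sup>2 * (norm (d *\<^sub>R y))\<^sup>2 - (c *\<^sub>R x \<bullet> d *\<^sub>R y)\<^sup>2 =
      (\<bar>c\<bar> * \<bar>d\<bar>)\<^sup>2 * ((norm x)\<^sup>2 * (norm y)\<^sup>2 - (x \<bullet> y)\<^sup>2)"
    by (simp add: power_mult_distrib algebra_simps)
  then show ?thesis
    by (simp only: wedge_norm_eq real_sqrt_mult real_sqrt_abs) (simp add: abs_mult)
qed

lemma wedge_norm_unit:
  assumes "norm x = 1" "norm z = 1"
  shows "wedge_norm x z = norm (z - (x \<bullet> z) *\<^sub>R x)"
    and "wedge_norm x z \<le> norm (z - c *\<^sub>R x)"
proof -
  have x1: "x \<bullet> x = 1" and z1: "z \<bullet> z = 1"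
    using assms by (simp_all add: norm_eq_1)
  have n2: "(norm (z - t *\<^sub>R x))\<^sup>2 = 1 - (x \<bullet> z)\<^sup>2 + (t - x \<bullet> z)\<^sup>2" for t
    unfolding power2_norm_eq_inner
    by (simp add: inner_diff x1 z1 inner_commute power2_eq_square algebra_simps)
  have w2: "(wedge_norm x z)\<^sup>2 = 1 - (x \<bullet> z)\<^sup>2"
    by (simp add: wedge_norm_power2 assms)
  show "wedge_norm x z = norm (z - (x \<bullet> z) *\<^sub>R x)"
    by (rule power2_eq_imp_eq) (auto simp: w2 n2 wedge_norm_nonneg)
  show "wedge_norm x z \<le> norm (z - c *\<^sub>R x)"
    by (rule power2_le_imp_le) (auto simp: w2 n2)
qed

lemma wedge_norm_triangle_unit:
  assumes "norm x = 1" "norm y = 1" "norm z = 1"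
  shows "wedge_norm x z \<le> wedge_norm x y + wedge_norm y z"
proof -
  let ?c = "y \<bullet> z"
  have "wedge_norm x z \<le> norm (z - (?c * (x \<bullet> y)) *\<^sub>R x)"
    using assms by (intro wedge_norm_unit)
  also have "z - (?c * (x \<bullet> y)) *\<^sub>R x = (z - ?c *\<^sub>R y) + ?c *\<^sub>R (y - (x \<bullet> y) *\<^sub>R x)"
    by (simp add: algebra_simps)
  also have "norm \<dots> \<le> norm (z - ?c *\<^sub>R y) + \<bar>?c\<bar> * norm (y - (x \<bullet> y) *\<^sub>R x)"
    by (metis norm_triangle_ineq norm_scaleR)
  also have "\<dots> = wedge_norm y z + \<bar>?c\<bar> * wedge_norm x y"
    using assms by (simp add: wedge_norm_unit(1))
  also have "\<bar>?c\<bar> * wedge_norm x y \<le> 1 * wedge_norm x y"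
    using Cauchy_Schwarz_ineq2[of y z] assms
    by (intro mult_right_mono) (auto simp: wedge_norm_nonneg)
  finally show ?thesis by simp
qed

lemma wedge_norm_unit_eq_0:
  assumes "norm x = 1" "norm y = 1"
  shows "wedge_norm x y = 0 \<longleftrightarrow> (\<exists>c. c \<noteq> 0 \<and> y = c *\<^sub>R x)"
proof
  assume "wedge_norm x y = 0"
  then have "y = (x \<bullet> y) *\<^sub>R x"
    using wedge_norm_unit(1)[OF assms] by simp
  moreover from this have "x \<bullet> y \<noteq> 0"
    using assms by auto
  ultimately show "\<exists>c. c \<noteq> 0 \<and> y = c *\<^sub>R x" by blast
next
  assume "\<exists>c. c \<noteq> 0 \<and> y = c *\<^sub>R x"
  then obtain c where "y = c *\<^sub>R x" by blast
  then show "wedge_norm x y = 0"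
    using wedge_norm_unit(2)[OF assms, of c] wedge_norm_nonneg[of x y] by simp
qed


section \<open>Real projective space as a metric space\<close>

definition proj_rel :: "real ^ 'n \<Rightarrow> real ^ 'n \<Rightarrow> bool" where
  "proj_rel x y \<longleftrightarrow> x \<noteq> 0 \<and> y \<noteq> 0 \<and> (\<exists>c. c \<noteq> 0 \<and> y = c *\<^sub>R x)"

lemma proj_rel_part_equivp: "part_equivp proj_rel"
proof (rule part_equivpI)
  show "\<exists>x::real^'n. proj_rel x x"
    by (rule exI[of _ "axis undefined 1"]) (auto simp: proj_rel_def intro: exI[of _ 1])
  show "symp (proj_rel :: real^'n \<Rightarrow> _)"
  proof (rule sympI)
    fix x y :: "real^'n"
    assume "proj_rel x y"
    then obtain c where "x \<noteq> 0" "y \<noteq> 0" "c \<noteq> 0" "y = c *\<^sub>R x"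
      by (auto simp: proj_rel_def)
    then show "proj_rel y x"
      unfolding proj_rel_def by (intro conjI exI[of _ "inverse c"]) auto
  qed
  show "transp (proj_rel :: real^'n \<Rightarrow> _)"
  proof (rule transpI)
    fix x y z :: "real^'n"
    assume "proj_rel x y" "proj_rel y z"
    then obtain c d where "x \<noteq> 0" "z \<noteq> 0" "c \<noteq> 0" "d \<noteq> 0" "y = c *\<^sub>R x" "z = d *\<^sub>R y"
      by (auto simp: proj_rel_def)
    then show "proj_rel x z"
      unfolding proj_rel_def by (intro conjI exI[of _ "d * c"]) auto
  qed
qed

quotient_type (overloaded) 'n proj = "real ^ ('n::finite)" / partial: proj_rel
  morphisms rep_proj proj_point
  by (rule proj_rel_part_equivp)

text \<open>
  \<^term>\<open>proj_point\<close> is the quotient map $\phi$; it is meaningful on nonzero vectors only.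
\<close>

lemma proj_point_eq_iff:
  assumes "x \<noteq> 0" "y \<noteq> 0"
  shows "proj_point x = proj_point y \<longleftrightarrow> (\<exists>c. c \<noteq> 0 \<and> y = c *\<^sub>R x)"
proof -
  have refl: "proj_rel v v" if "v \<noteq> 0" for v :: "real ^ 'n"
    using that by (auto simp: proj_rel_def intro: exI[of _ 1])
  have "proj_point x = proj_point y \<longleftrightarrow> proj_rel x y"
    using Quotient3_rel[OF Quotient3_proj, of x y] refl[OF assms(1)] refl[OF assms(2)] by blast
  then show ?thesis using assms by (simp add: proj_rel_def)
qed

lemma proj_point_unit_cases:
  obtains x where "norm x = 1" "p = proj_point x"
proof -
  obtain v where v: "v \<noteq> 0" "p = proj_point v"
    by (metis Quotient3_abs_rep[OF Quotient3_proj] Quotient3_rep_reflp[OF Quotient3_proj]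
        proj_rel_def)
  then have "proj_point v = proj_point (inverse (norm v) *\<^sub>R v)"
    by (subst proj_point_eq_iff) (auto intro!: exI[of _ "inverse (norm v)"])
  with v show thesis
    by (intro that[of "inverse (norm v) *\<^sub>R v"]) auto
qed

instantiation proj :: (finite) metric_space
begin

lift_definition dist_proj :: "'a proj \<Rightarrow> 'a proj \<Rightarrow> real"
  is "\<lambda>x y. wedge_norm x y / (norm x * norm y)"
  by (auto simp: proj_rel_def wedge_norm_scaleR)

definition uniformity_proj :: "('a proj \<times> 'a proj) filter" where
  "uniformity_proj = (INF e\<in>{0<..}. principal {(x, y). dist x y < e})"

definition open_proj :: "'a proj set \<Rightarrow> bool" where
  "open_proj U \<longleftrightarrow> (\<forall>x\<in>U. eventually (\<lambda>(x', y). x' = x \<longrightarrow> y \<in> U) uniformity)"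

lemma dist_proj_point:
  assumes "x \<noteq> 0" "y \<noteq> 0"
  shows "dist (proj_point x) (proj_point y) = wedge_norm x y / (norm x * norm y)"
proof -
  have "proj_rel x x" "proj_rel y y"
    using assms by (auto simp: proj_rel_def intro: exI[of _ 1])
  then show ?thesis by (rule dist_proj.abs_eq)
qed

lemma dist_proj_point_unit:
  assumes "norm x = 1" "norm y = 1"
  shows "dist (proj_point x) (proj_point y) = wedge_norm x y"
  using assms by (subst dist_proj_point) auto

instance
proof
  fix p q r :: "'a proj"
  obtain x where x: "norm x = 1" "p = proj_point x" by (rule proj_point_unit_cases)
  obtain y where y: "norm y = 1" "q = proj_point y" by (rule proj_point_unit_cases)
  obtain z where z: "norm z = 1" "r = proj_point z" by (rule proj_point_unit_cases)
  have nz: "x \<noteq> 0" "y \<noteq> 0" using x y by auto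
  show "dist p q = 0 \<longleftrightarrow> p = q"
    using x y by (simp add: dist_proj_point_unit wedge_norm_unit_eq_0 proj_point_eq_iff[OF nz])
  show "dist p q \<le> dist p r + dist q r"
    using x y z wedge_norm_triangle_unit[of x z y]
    by (simp add: dist_proj_point_unit wedge_norm_commute)
qed (simp_all add: uniformity_proj_def open_proj_def)

end


section \<open>Rational points and their height\<close>

definition rat_points :: "('n::finite) proj set" where
  "rat_points = {proj_point x | x. x \<noteq> 0 \<and> (\<forall>i. x $ i \<in> \<rat>)}"

definition real_vec :: "int ^ 'n \<Rightarrow> real ^ 'n" where
  "real_vec v = (\<chi> i. real_of_int (v $ i))"

definition primitive_rep :: "('n::finite) proj \<Rightarrow> int ^ 'n \<Rightarrow> bool" where
  "primitive_rep q v \<longleftrightarrow> v \<noteq> 0 \<and> Gcd (range (($) v)) = 1 \<and> q = proj_point (real_vec v)"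

definition height :: "('n::finite) proj \<Rightarrow> nat" where
  "height q = (THE h. \<exists>v. primitive_rep q v \<and> int h = Max (range (\<lambda>i. \<bar>v $ i\<bar>)))"

text \<open>
  A rational point has a primitive integer representative, unique up to sign, so the height
  is well defined.
\<close>

lemma real_vec_eq_0_iff: "real_vec v = 0 \<longleftrightarrow> v = 0"
  by (simp add: real_vec_def vec_eq_iff)

lemma primitive_rep_exists:
  fixes q :: "('n::finite) proj"
  assumes "q \<in> rat_points"
  shows "\<exists>v. primitive_rep q v"
proof -
  obtain x where x: "x \<noteq> 0" "\<And>i. x $ i \<in> \<rat>" "q = proj_point x"
    using assms by (auto simp: rat_points_def)
  have "\<exists>a b. b > 0 \<and> x $ i = real_of_int a / real_of_int b" for i
    using x(2)[of i] by (metis Rats_cases' of_int_0_less_iff)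
  then obtain a b where b: "\<And>i. b i > 0" and ab: "\<And>i. x $ i = real_of_int (a i) / real_of_int (b i)"
    by metis
  define d where "d = (\<Prod>i\<in>UNIV. b i)"
  have d: "d > 0" unfolding d_def using b by (intro prod_pos) auto
  define u where "u i = a i * (d div b i)" for i
  have u: "real_of_int (u i) = real_of_int d * x $ i" for i
  proof -
    have "b i dvd d" unfolding d_def by (intro dvd_prodI) auto
    then show ?thesis
      using b[of i] by (simp add: u_def ab real_of_int_div)
  qed
  define g where "g = Gcd (range u)"
  have g: "g > 0"
  proof -
    obtain i where "x $ i \<noteq> 0" using x(1) by (auto simp: vec_eq_iff)
    then have "u i \<noteq> 0" using u[of i] d by auto
    then have "g \<noteq> 0" unfolding g_def by (auto simp: Gcd_0_iff)
    moreover have "g \<ge> 0" unfolding g_def by simp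
    ultimately show ?thesis by simp
  qed
  define v :: "int ^ 'n" where "v = (\<chi> i. u i div g)"
  have gv: "u i = g * v $ i" for i
    unfolding v_def g_def by (simp add: Gcd_dvd)
  have "g = Gcd ((*) g ` range (($) v))"
    unfolding image_image gv[symmetric] by (simp add: g_def)
  also have "\<dots> = g * Gcd (range (($) v))"
    using g by (simp add: Gcd_mult abs_mult)
  finally have Gv: "Gcd (range (($) v)) = 1" using g by simp
  have gx: "real_of_int g * real_of_int (v $ i) = real_of_int d * x $ i" for i
    using u[of i] gv[of i] by simp
  have xv: "x = (real_of_int g / real_of_int d) *\<^sub>R real_vec v"
    using gx d by (simp add: vec_eq_iff real_vec_def field_simps)
  then have v0: "v \<noteq> 0" using x(1) by (auto simp: real_vec_eq_0_iff)
  have "proj_point (real_vec v) = proj_point x"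
    using v0 x(1) xv g d
    by (subst proj_point_eq_iff)
      (auto simp: real_vec_eq_0_iff intro!: exI[of _ "real_of_int g / real_of_int d"])
  with v0 Gv x(3) show ?thesis by (auto simp: primitive_rep_def)
qed

lemma primitive_rep_unique:
  assumes v: "primitive_rep q v" and w: "primitive_rep q w"
  shows "w = v \<or> w = - v"
proof -
  obtain c where c: "c \<noteq> 0" "real_vec w = c *\<^sub>R real_vec v"
    using v w proj_point_eq_iff[of "real_vec v" "real_vec w"]
    by (auto simp: primitive_rep_def real_vec_eq_0_iff)
  then have wc: "real_of_int (w $ i) = c * real_of_int (v $ i)" for i
    by (simp add: vec_eq_iff real_vec_def)
  obtain i where i: "v $ i \<noteq> 0" using v by (auto simp: primitive_rep_def vec_eq_iff)
  have cross: "v $ i * w $ j = w $ i * v $ j" for j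
  proof -
    have "real_of_int (v $ i * w $ j) = real_of_int (w $ i * v $ j)"
      by (simp add: wc)
    then show ?thesis by (simp only: of_int_eq_iff)
  qed
  have "\<bar>v $ i\<bar> = Gcd ((*) (v $ i) ` range (($) w))"
    using w by (simp add: Gcd_mult primitive_rep_def)
  also have "\<dots> = Gcd ((*) (w $ i) ` range (($) v))"
    by (simp only: image_image cross)
  also have "\<dots> = \<bar>w $ i\<bar>"
    using v by (simp add: Gcd_mult primitive_rep_def)
  finally consider "w $ i = v $ i" | "w $ i = - v $ i"
    by linarith
  then show ?thesis
  proof cases
    case 1
    with cross i show ?thesis by (simp add: vec_eq_iff)
  next
    case 2
    then have "v $ i * w $ j = v $ i * - v $ j" for j
      using cross[of j] by simp
    with i have "w $ j = - v $ j" for j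
      by (metis mult_left_cancel)
    then show ?thesis by (simp add: vec_eq_iff)
  qed
qed

lemma height_eq:
  assumes "primitive_rep q v"
  shows "int (height q) = Max (range (\<lambda>i. \<bar>v $ i\<bar>))"
proof -
  let ?M = "\<lambda>v. Max (range (\<lambda>i. \<bar>v $ i\<bar>))"
  have M: "?M w = ?M v" if "primitive_rep q w" for w
    using primitive_rep_unique[OF assms that] by auto
  have "\<bar>v $ undefined\<bar> \<le> ?M v"
    by (intro Max_ge) auto
  then have "0 \<le> ?M v"
    by linarith
  then have M0: "int (nat (?M v)) = ?M v"
    by simp
  have "height q = nat (?M v)"
    unfolding height_def
  proof (rule the_equality)
    show "\<exists>w. primitive_rep q w \<and> int (nat (?M v)) = ?M w"
      using assms M0 by blast
  next
    fix h assume "\<exists>w. primitive_rep q w \<and> int h = ?M w"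
    then have "int h = ?M v" using M by auto
    then show "h = nat (?M v)" by simp
  qed
  with M0 show ?thesis by simp
qed


section \<open>Conditions on measures\<close>

definition locally_finite_borel_on :: "'a::topological_space set \<Rightarrow> 'a measure \<Rightarrow> bool" where
  "locally_finite_borel_on \<Omega> \<mu> \<longleftrightarrow>
     sets \<mu> = sets borel \<and>
     (\<forall>x. \<exists>U. open U \<and> x \<in> U \<and> emeasure \<mu> U < \<infinity>) \<and>
     emeasure \<mu> (- \<Omega>) = 0"

definition ahlfors_regular :: "'a::metric_space set \<Rightarrow> 'a measure \<Rightarrow> real \<Rightarrow> bool" where
  "ahlfors_regular \<Omega> \<mu> \<delta> \<longleftrightarrow>
     (\<exists>r0>0. \<exists>a b. 0 < a \<and> a \<le> 1 \<and> 1 \<le> b \<and>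
        (\<forall>x\<in>\<Omega>. \<forall>r. 0 < r \<and> r < r0 \<and> r \<le> sin 1 \<longrightarrow>
           ennreal (a * r powr \<delta>) \<le> emeasure \<mu> (cball x r) \<and>
           emeasure \<mu> (cball x r) \<le> ennreal (b * r powr \<delta>)))"

definition proj_hyperplane :: "('n::finite) proj set \<Rightarrow> bool" where
  "proj_hyperplane P \<longleftrightarrow>
     (\<exists>L :: (real ^ 'n) set. subspace L \<and> dim L + 1 = CARD('n) \<and> P = proj_point ` (L - {0}))"

text \<open>
  For \<^term>\<open>CARD('n) \<ge> 2\<close> projective hyperplanes are nonempty, so \<^term>\<open>infdist\<close> is a
  genuine infimum here.
\<close>

definition hyperplane_nbhd :: "('n::finite) proj set \<Rightarrow> real \<Rightarrow> 'n proj set" where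
  "hyperplane_nbhd P \<epsilon> = {x. infdist x P < \<epsilon>}"

definition proj_abs_decaying :: "('n::finite) proj set \<Rightarrow> 'n proj measure \<Rightarrow> real \<Rightarrow> bool" where
  "proj_abs_decaying \<Omega> \<mu> \<eta> \<longleftrightarrow>
     (\<exists>c>0. \<exists>r0>0. \<forall>P \<epsilon>. proj_hyperplane P \<and> \<epsilon> > 0 \<longrightarrow>
        (\<forall>x\<in>\<Omega>. \<forall>r. 0 < r \<and> r < r0 \<and> r \<le> sin 1 \<longrightarrow>
           emeasure \<mu> (cball x r \<inter> hyperplane_nbhd P \<epsilon>)
             \<le> ennreal (c * (\<epsilon> / r) powr \<eta>) * emeasure \<mu> (cball x r)))"

end

theory Submission
  imports Defs
begin

text \<open>
  Write $n = N + 1$. Linearly independent integer vectors have determinant at least 1 in absolute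
  value, while $n$ vectors of norm at most $L$ whose lines lie within $r$ of a common line have
  determinant $O(L^n r^N)$. Hence the rational points of height at most $2^{t+1}$ in a ball of
  radius $r_t$, a small multiple of $2^{-t(N+1)/N}$, lie in a single projective hyperplane. By
  Ahlfors regularity $\Omega$ is covered by balls of radius $r_t$ whose total measure is bounded
  independently of $t$, so the decay condition bounds the measure of the set of points within
  $\psi(2^t)$ of those rational points by a constant times $(2^{t(N+1)/N} \psi(2^t))^\eta$. By
  Cauchy condensation these bounds are summable (so that also $\psi(2^t) \le r_t$ eventually), and
  the Borel--Cantelli lemma applies.
\<close>

section \<open>The simplex lemma\<close>

text \<open>In the Leibniz expansion each permutation takes one entry from every column. Separate
  column bounds allow one long column beside many short ones.\<close>

lemma abs_det_le_prod:
  fixes A :: "real ^ 'n ^ 'n"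
  assumes le: "\<And>i j. \<bar>A $ i $ j\<bar> \<le> c j"
  shows "\<bar>det A\<bar> \<le> fact CARD('n) * (\<Prod>j\<in>UNIV. c j)"
proof -
  have "\<bar>det A\<bar> \<le> (\<Sum>p | p permutes (UNIV :: 'n set). \<bar>of_int (sign p) * (\<Prod>i\<in>UNIV. A $ i $ p i)\<bar>)"
    unfolding det_def by (rule sum_abs)
  also have "\<dots> \<le> (\<Sum>p | p permutes (UNIV :: 'n set). \<Prod>j\<in>UNIV. c j)"
  proof (rule sum_mono)
    fix p assume "p \<in> {p. p permutes (UNIV :: 'n set)}"
    then have p: "p permutes UNIV" by simp
    have "\<bar>of_int (sign p) * (\<Prod>i\<in>UNIV. A $ i $ p i)\<bar> = (\<Prod>i\<in>UNIV. \<bar>A $ i $ p i\<bar>)"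
      by (simp add: abs_mult abs_prod sign_def)
    also have "\<dots> \<le> (\<Prod>i\<in>UNIV. c (p i))"
      using le by (intro prod_mono) auto
    also have "\<dots> = (\<Prod>j\<in>UNIV. c j)"
      by (rule prod.reindex_bij_betw) (rule permutes_imp_bij[OF p])
    finally show "\<bar>of_int (sign p) * (\<Prod>i\<in>UNIV. A $ i $ p i)\<bar> \<le> (\<Prod>j\<in>UNIV. c j)" .
  qed
  also have "\<dots> = fact CARD('n) * (\<Prod>j\<in>UNIV. c j)"
    by (simp add: card_permutations)
  finally show ?thesis .
qed

text \<open>Rotate \<open>x\<close> onto a coordinate axis, which preserves the absolute
  determinant. Each row then has a coordinate of size at most \<open>L\<close> along the axis, and
  its other coordinates are at most its distance from the line of \<open>x\<close>, which is
  \<open>wedge_norm\<close>.\<close>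

lemma abs_det_le_wedge:
  fixes A :: "real ^ 'n ^ 'n"
  assumes x: "norm x = 1"
    and L: "\<And>i. norm (A $ i) \<le> L"
    and W: "\<And>i. wedge_norm x (A $ i) \<le> W"
  shows "\<bar>det A\<bar> \<le> fact CARD('n) * (L * W ^ (CARD('n) - 1))"
proof -
  \<comment> \<open>Any index may serve as the axis; this only fixes a name for one.\<close>
  obtain k :: 'n where True by blast
  obtain f :: "real ^ 'n \<Rightarrow> real ^ 'n"
    where f: "orthogonal_transformation f" and fx: "f x = axis k 1"
    using orthogonal_transformation_exists_1[OF x, of "axis k 1"] by auto
  define R where "R = matrix f"
  have lin: "linear f" and R: "orthogonal_matrix R"
    using f by (simp_all add: R_def orthogonal_transformation_matrix)
  have Rf: "R *v v = f v" for v
    unfolding R_def using lin by (simp add: matrix_vector_mul(2)[symmetric] matrix_vector_mul)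
  have nf: "norm (f v) = norm v" for v
    by (rule orthogonal_transformation_norm[OF f])
  have fk: "f v $ k = x \<bullet> v" for v
  proof -
    have "f v $ k = f v \<bullet> f x" by (simp add: fx inner_axis)
    also have "\<dots> = x \<bullet> v"
      using f by (simp add: orthogonal_transformation_def inner_commute)
    finally show ?thesis .
  qed
  \<comment> \<open>The \<open>k\<close>-th coordinate of \<open>f v\<close> is the inner product of
    \<open>x\<close> and \<open>v\<close>, so the other squares sum to the norm squared minus its
    square, which is the squared wedge norm.\<close>
  have fj: "\<bar>f v $ j\<bar> \<le> wedge_norm x v" if "j \<noteq> k" for v j
  proof (rule power2_le_imp_le)
    have "(f v $ k)\<^sup>2 + (f v $ j)\<^sup>2 = (\<Sum>i\<in>{k, j}. (f v $ i)\<^sup>2)"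
      using that by simp
    also have "\<dots> \<le> (\<Sum>i\<in>UNIV. (f v $ i)\<^sup>2)"
      by (intro sum_mono2) auto
    also have "\<dots> = (norm v)\<^sup>2"
      unfolding nf[of v, symmetric] power2_norm_eq_inner inner_vec_def
      by (simp add: power2_eq_square)
    finally show "\<bar>f v $ j\<bar>\<^sup>2 \<le> (wedge_norm x v)\<^sup>2"
      by (simp add: wedge_norm_power2 x fk)
  qed (rule wedge_norm_nonneg)
  \<comment> \<open>Right multiplication by the transpose applies the rotation to each row.\<close>
  define B where "B = A ** transpose R"
  have B: "B $ i $ j = f (A $ i) $ j" for i j
    unfolding Rf[symmetric] B_def
    by (simp add: matrix_matrix_mult_def matrix_vector_mult_def transpose_def mult.commute)
  have "\<bar>det B\<bar> = \<bar>det A\<bar>"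
    using det_orthogonal_matrix[OF R] by (auto simp: B_def det_mul det_transpose abs_mult)
  moreover have "\<bar>det B\<bar> \<le> fact CARD('n) * (\<Prod>j\<in>UNIV. if j = k then L else W)"
  proof (rule abs_det_le_prod)
    fix i j
    show "\<bar>B $ i $ j\<bar> \<le> (if j = k then L else W)"
      using fj[of j "A $ i"] W[of i] L[of i] component_le_norm_cart[of "f (A $ i)" j]
      by (auto simp: B nf)
  qed
  moreover have "(\<Prod>j\<in>UNIV. if j = k then L else W) = L * W ^ (CARD('n) - 1)"
    by (simp add: prod.If_cases Compl_eq_Diff_UNIV card_Diff_singleton)
  ultimately show ?thesis by simp
qed

lemma det_Ints:
  fixes A :: "real ^ 'n ^ 'n"
  assumes "\<And>i j. A $ i $ j \<in> \<int>"
  shows "det A \<in> \<int>"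
  unfolding det_def using assms by (intro Ints_sum Ints_mult Ints_prod) auto

text \<open>If \<open>S\<close> spanned the whole space, a basis chosen from it would form an
  integer matrix with nonzero determinant, hence of absolute value at least 1, against the bound in
  \<open>small\<close>.\<close>

lemma integer_vectors_subset_hyperplane:
  fixes x :: "real ^ 'n"
  assumes x: "norm x = 1"
    and Z: "\<And>v i. v \<in> S \<Longrightarrow> v $ i \<in> \<int>"
    and L: "\<And>v. v \<in> S \<Longrightarrow> norm v \<le> L"
    and W: "\<And>v. v \<in> S \<Longrightarrow> wedge_norm x v \<le> W"
    and small: "fact CARD('n) * (L * W ^ (CARD('n) - 1)) < 1"
  shows "\<exists>a. a \<noteq> 0 \<and> S \<subseteq> {v. a \<bullet> v = 0}"
proof (cases "dim S < CARD('n)")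
  case True
  then obtain a :: "real ^ 'n" where "a \<noteq> 0" "span S \<subseteq> {v. a \<bullet> v = 0}"
    using lowdim_subset_hyperplane[of S] by auto
  then show ?thesis using span_superset[of S] by blast
next
  case False
  then have full: "dim S = CARD('n)"
    using dim_subset_UNIV_cart[of S] by simp
  obtain B where B: "B \<subseteq> S" "independent B" "S \<subseteq> span B" "card B = dim S"
    by (rule basis_exists)
  have "finite B" using B(2) by (rule independent_imp_finite)
  then obtain h where h: "bij_betw h (UNIV :: 'n set) B"
    using finite_same_card_bij[of "UNIV :: 'n set" B] B(4) full by auto
  define A :: "real ^ 'n ^ 'n" where "A = (\<chi> i. h i)"
  have hS: "h i \<in> S" for i
    using h B(1) by (auto simp: bij_betw_def)
  have "rows A = B"
    using h by (auto simp: rows_def row_def A_def vec_nth_inverse bij_betw_def)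
  moreover have "span B = UNIV"
    using full B dim_eq_full[of B] dim_eq_card_independent[OF B(2)] by simp
  ultimately have "det A \<noteq> 0"
    by (simp add: invertible_det_nz[symmetric] invertible_left_inverse
        matrix_left_invertible_span_rows)
  moreover have "det A \<in> \<int>"
    by (rule det_Ints) (simp add: A_def Z[OF hS])
  ultimately have "1 \<le> \<bar>det A\<bar>"
    by (simp add: Ints_nonzero_abs_ge1)
  also have "\<bar>det A\<bar> \<le> fact CARD('n) * (L * W ^ (CARD('n) - 1))"
    by (rule abs_det_le_wedge[OF x]) (simp_all add: A_def L[OF hS] W[OF hS])
  finally show ?thesis using small by simp
qed

section \<open>Points of bounded height and the projective form of the simplex lemma\<close>

lemma abs_primitive_rep_le_height:
  assumes "primitive_rep q v"
  shows "\<bar>v $ i\<bar> \<le> int (height q)"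
  unfolding height_eq[OF assms] by (intro Max_ge) auto

lemma height_pos:
  assumes "q \<in> rat_points"
  shows "0 < height q"
proof -
  obtain v where v: "primitive_rep q v"
    using primitive_rep_exists[OF assms] by blast
  then obtain i where "v $ i \<noteq> 0"
    by (auto simp: primitive_rep_def vec_eq_iff)
  with abs_primitive_rep_le_height[OF v, of i] show ?thesis by linarith
qed

text \<open>Northcott finiteness: a point is determined by a primitive representative, and height at
  most \<open>H\<close> confines that to a finite box of integer vectors.\<close>

lemma finite_rat_points_height_le: "finite {q \<in> (rat_points :: ('n::finite) proj set). height q \<le> H}"
proof (rule finite_subset)
  let ?F = "Pi\<^sub>E (UNIV :: 'n set) (\<lambda>_. {- int H .. int H})"
  show "{q \<in> (rat_points :: 'n proj set). height q \<le> H}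
      \<subseteq> (\<lambda>g. proj_point (real_vec (vec_lambda g))) ` ?F"
  proof
    fix q :: "'n proj" assume "q \<in> {q \<in> rat_points. height q \<le> H}"
    then obtain v where v: "primitive_rep q v" and H: "height q \<le> H"
      using primitive_rep_exists by blast
    have "v $ i \<in> {- int H .. int H}" for i
      using abs_primitive_rep_le_height[OF v, of i] H by auto
    moreover have "q = proj_point (real_vec (vec_lambda (($) v)))"
      using v by (simp add: primitive_rep_def)
    ultimately show "q \<in> (\<lambda>g. proj_point (real_vec (vec_lambda g))) ` ?F"
      by (intro image_eqI[of _ _ "($) v"]) auto
  qed
  show "finite ((\<lambda>g. proj_point (real_vec (vec_lambda g))) ` ?F)"
    by (intro finite_imageI finite_PiE) auto
qed

text \<open>With n = \<open>CARD('n)\<close>, a primitive representative has Euclidean norm at most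
  its l1 norm, hence at most L = n H. At distance at most r from p its wedge norm with a unit vector
  of p is at most L r, so the determinant bound becomes n! L^n r^(n-1), the quantity in
  \<open>small\<close>.\<close>

lemma rat_points_cball_subset_hyperplane:
  fixes p :: "('n::finite) proj"
  assumes r: "0 \<le> r"
    and small: "fact CARD('n) * (real CARD('n) * real H) ^ CARD('n) * r ^ (CARD('n) - 1) < 1"
  shows "\<exists>P. proj_hyperplane P \<and> {q \<in> rat_points. height q \<le> H} \<inter> cball p r \<subseteq> P"
proof -
  obtain x where x: "norm x = 1" "p = proj_point x" by (rule proj_point_unit_cases)
  define L where "L = real CARD('n) * real H"
  define S where "S = {real_vec v | v. v \<noteq> 0 \<and> norm (real_vec v) \<le> L \<and> wedge_norm x (real_vec v) \<le> L * r}"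
  have "fact CARD('n) * (L * (L * r) ^ (CARD('n) - 1)) =
      fact CARD('n) * (L * L ^ (CARD('n) - 1)) * r ^ (CARD('n) - 1)"
    by (simp add: power_mult_distrib)
  also have "L * L ^ (CARD('n) - 1) = L ^ CARD('n)"
    by (simp flip: power_Suc)
  finally have "fact CARD('n) * (L * (L * r) ^ (CARD('n) - 1)) < 1"
    using small unfolding L_def by argo
  \<comment> \<open>\<open>rotated 3\<close> puts the smallness premise first, so the chained fact
    fixes both size bounds before membership in \<open>S\<close> is unfolded.\<close>
  then have "\<exists>a. a \<noteq> 0 \<and> S \<subseteq> {v. a \<bullet> v = 0}"
    by (rule integer_vectors_subset_hyperplane[OF x(1), rotated 3])
      (auto simp: S_def real_vec_def)
  then obtain a where a: "a \<noteq> 0" "S \<subseteq> {v. a \<bullet> v = 0}"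
    by blast
  let ?P = "proj_point ` ({v. a \<bullet> v = 0} - {0})"
  have "proj_hyperplane ?P"
    unfolding proj_hyperplane_def using a(1)
    by (intro exI[of _ "{v. a \<bullet> v = 0}"]) (simp add: subspace_hyperplane dim_hyperplane)
  moreover have "q \<in> ?P" if q: "q \<in> rat_points" "height q \<le> H" "dist p q \<le> r" for q
  proof -
    obtain v where v: "primitive_rep q v"
      using primitive_rep_exists[OF q(1)] by blast
    then have nz: "real_vec v \<noteq> 0" and qv: "q = proj_point (real_vec v)"
      by (auto simp: primitive_rep_def real_vec_eq_0_iff)
    have "\<bar>real_vec v $ i\<bar> \<le> real H" for i
      using abs_primitive_rep_le_height[OF v, of i] q(2) by (simp add: real_vec_def)
    then have "(\<Sum>i\<in>UNIV. \<bar>real_vec v $ i\<bar>) \<le> L"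
      unfolding L_def by (rule sum_bounded_above[of UNIV, simplified])
    then have vL: "norm (real_vec v) \<le> L"
      using norm_le_l1_cart[of "real_vec v"] by linarith
    have x0: "x \<noteq> 0" using x(1) by auto
    have "wedge_norm x (real_vec v) \<le> r * norm (real_vec v)"
      using q(3) nz x(1) by (simp add: x(2) qv dist_proj_point[OF x0 nz] divide_simps)
    also have "\<dots> \<le> L * r"
      using mult_left_mono[OF vL r] by (simp add: mult.commute)
    finally have "real_vec v \<in> S"
      using vL nz by (auto simp: S_def real_vec_eq_0_iff)
    with a(2) nz qv show ?thesis by auto
  qed
  ultimately show ?thesis
    by (intro exI[of _ ?P]) auto
qed

section \<open>Separated covers\<close>

text \<open>Take a largest separated subset of a finite s-net. By maximality every net point is
  within s of it, so every point of \<open>K\<close> is within 2s. Working inside a finite net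
  bounds the cardinalities, so a largest subset exists.\<close>

lemma compact_separated_cover:
  fixes K :: "'a::metric_space set"
  assumes "compact K" "0 < s"
  shows "\<exists>F. finite F \<and> F \<subseteq> K \<and> (\<forall>x\<in>F. \<forall>y\<in>F. x \<noteq> y \<longrightarrow> s < dist x y) \<and> K \<subseteq> (\<Union>x\<in>F. cball x (2 * s))"
proof -
  obtain G where G: "finite G" "G \<subseteq> K" "K \<subseteq> (\<Union>x\<in>G. ball x s)"
    using compactE_image[OF assms(1), of K "\<lambda>x. ball x s"] assms(2) by force
  define sep where "sep F \<longleftrightarrow> F \<subseteq> G \<and> (\<forall>x\<in>F. \<forall>y\<in>F. x \<noteq> y \<longrightarrow> s < dist x y)" for F
  have "sep {}" by (simp add: sep_def)
  moreover have "\<forall>F. sep F \<longrightarrow> card F < Suc (card G)"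
    using G(1) by (auto simp: sep_def less_Suc_eq_le intro: card_mono)
  ultimately have "\<exists>F. sep F \<and> (\<forall>F'. sep F' \<longrightarrow> card F' \<le> card F)"
    by (rule ex_has_greatest_nat[where f = card])
  then obtain F where F: "sep F" and max: "\<And>F'. sep F' \<Longrightarrow> card F' \<le> card F"
    by blast
  have finF: "finite F" using F G(1) by (auto simp: sep_def intro: finite_subset)
  have near: "\<exists>x\<in>F. dist x g \<le> s" if g: "g \<in> G" for g
  proof (rule ccontr)
    assume "\<not> (\<exists>x\<in>F. dist x g \<le> s)"
    then have far: "\<And>x. x \<in> F \<Longrightarrow> s < dist x g" by force
    then have "sep (insert g F)"
      using F g by (auto simp: sep_def dist_commute)
    moreover have "g \<notin> F" using far[of g] assms(2) by auto
    ultimately show False using max[of "insert g F"] finF by simp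
  qed
  have "K \<subseteq> (\<Union>x\<in>F. cball x (2 * s))"
  proof
    fix y assume "y \<in> K"
    then obtain g where g: "g \<in> G" "dist g y < s" using G(3) by auto
    obtain x where x: "x \<in> F" "dist x g \<le> s" using near[OF g(1)] by blast
    have "dist x y \<le> 2 * s" using dist_triangle[of x y g] g x by linarith
    with x(1) show "y \<in> (\<Union>x\<in>F. cball x (2 * s))" by auto
  qed
  then show ?thesis
    using F G(2) finF by (intro exI[of _ F]) (auto simp: sep_def)
qed

section \<open>Finiteness of the measure, covers of bounded total mass, and the measure near
  rational points\<close>

lemma finite_measure_on_compact:
  fixes K :: "'a::t2_space set"
  assumes lf: "locally_finite_borel_on K \<mu>" and K: "compact K"
  shows "finite_measure \<mu>"
proof
  have sets: "sets \<mu> = sets borel" and null: "emeasure \<mu> (- K) = 0"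
    and loc: "\<forall>x. \<exists>U. open U \<and> x \<in> U \<and> emeasure \<mu> U < \<infinity>"
    using lf by (simp_all add: locally_finite_borel_on_def)
  obtain U where U: "\<And>x. open (U x)" "\<And>x. x \<in> U x" "\<And>x. emeasure \<mu> (U x) < \<infinity>"
    using loc by metis
  obtain C where C: "finite C" "K \<subseteq> (\<Union>x\<in>C. U x)"
    by (rule compactE_image[OF K, of K U]) (use U(1,2) in auto)
  have meas: "U x \<in> sets \<mu>" for x
    unfolding sets by (rule borel_open) (rule U(1))
  have "(\<Union>x\<in>C. U x) \<in> fmeasurable \<mu>"
    using C(1) U(3) meas by (intro fmeasurable.finite_UN fmeasurableI) auto
  then have UC: "(\<Union>x\<in>C. U x) \<in> sets \<mu>" and fin: "emeasure \<mu> (\<Union>x\<in>C. U x) < \<infinity>"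
    by (auto simp: fmeasurable_def)
  have sp: "space \<mu> = UNIV" using sets_eq_imp_space_eq[OF sets] by simp
  have "- (\<Union>x\<in>C. U x) \<in> sets \<mu>" using UC sp by (metis Compl_eq_Diff_UNIV sets.compl_sets)
  then have "emeasure \<mu> (space \<mu>) \<le> emeasure \<mu> (\<Union>x\<in>C. U x) + emeasure \<mu> (- (\<Union>x\<in>C. U x))"
    using emeasure_subadditive[OF UC, of "- (\<Union>x\<in>C. U x)"] by (simp only: Compl_partition sp)
  moreover have "emeasure \<mu> (- (\<Union>x\<in>C. U x)) \<le> emeasure \<mu> (- K)"
    using C(2) sets K by (intro emeasure_mono) (auto simp: open_Compl compact_imp_closed)
  ultimately show "emeasure \<mu> (space \<mu>) \<noteq> \<infinity>" using fin null by auto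
qed

text \<open>Centres more than r/2 apart have disjoint balls of radius r/4, whose total mass is at
  most that of the space. Regularity compares each ball of radius r with its concentric quarter, so
  \<open>C\<close> does not depend on r.\<close>

lemma ahlfors_regular_cover:
  fixes \<Omega> :: "'a::metric_space set"
  assumes K: "compact \<Omega>" and fm: "finite_measure \<mu>" and sets: "sets \<mu> = sets borel"
    and ar: "ahlfors_regular \<Omega> \<mu> \<delta>"
  obtains r1 C where "0 < r1" "0 \<le> C" "\<And>r. 0 < r \<Longrightarrow> r < r1 \<Longrightarrow>
    \<exists>F. finite F \<and> F \<subseteq> \<Omega> \<and> \<Omega> \<subseteq> (\<Union>x\<in>F. cball x r) \<and> (\<Sum>x\<in>F. measure \<mu> (cball x r)) \<le> C"
proof -
  interpret finite_measure \<mu> by (rule fm)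
  obtain r0 a b where r0: "0 < r0" and a: "0 < a" and b: "1 \<le> b"
    and ab: "\<And>x r. x \<in> \<Omega> \<Longrightarrow> 0 < r \<Longrightarrow> r < r0 \<Longrightarrow> r \<le> sin 1 \<Longrightarrow>
      ennreal (a * r powr \<delta>) \<le> emeasure \<mu> (cball x r) \<and>
      emeasure \<mu> (cball x r) \<le> ennreal (b * r powr \<delta>)"
    using ar unfolding ahlfors_regular_def by blast
  have lower: "a * r powr \<delta> \<le> measure \<mu> (cball x r)"
    and upper: "measure \<mu> (cball x r) \<le> b * r powr \<delta>"
    if "x \<in> \<Omega>" "0 < r" "r < r0" "r \<le> sin 1" for x r
    using ab[OF that] a b by (simp_all add: emeasure_eq_measure)
  have sin1: "0 < sin (1::real)"
    using pi_gt3 by (intro sin_gt_zero) auto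
  have cb: "cball x r \<in> sets \<mu>" for x r
    by (simp add: sets)
  \<comment> \<open>The first factor is the ratio of the upper regularity bound at radius r to the
    lower one at r/4.\<close>
  define C where "C = b * 4 powr \<delta> / a * measure \<mu> (space \<mu>)"
  have "\<exists>F. finite F \<and> F \<subseteq> \<Omega> \<and> \<Omega> \<subseteq> (\<Union>x\<in>F. cball x r) \<and> (\<Sum>x\<in>F. measure \<mu> (cball x r)) \<le> C"
    if r: "0 < r" "r < min r0 (sin 1)" for r
  proof -
    obtain F where F: "finite F" "F \<subseteq> \<Omega>" "\<Omega> \<subseteq> (\<Union>x\<in>F. cball x (2 * (r / 2)))"
      and sep: "\<And>x y. x \<in> F \<Longrightarrow> y \<in> F \<Longrightarrow> x \<noteq> y \<Longrightarrow> r / 2 < dist x y"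
      using compact_separated_cover[OF K, of "r / 2"] r(1) by auto
    \<comment> \<open>Strict separation matters: two closed quarter balls that meet have centres at
      distance at most r/2.\<close>
    have disj: "disjoint_family_on (\<lambda>x. cball x (r / 4)) F"
      unfolding disjoint_family_on_def
    proof (intro ballI impI)
      fix x y assume xy: "x \<in> F" "y \<in> F" "x \<noteq> y"
      show "cball x (r / 4) \<inter> cball y (r / 4) = {}"
      proof (rule equals0I)
        fix z assume "z \<in> cball x (r / 4) \<inter> cball y (r / 4)"
        then show False
          using sep[OF xy] dist_triangle2[of x y z] by auto
      qed
    qed
    have "(\<Sum>x\<in>F. measure \<mu> (cball x r)) \<le> (\<Sum>x\<in>F. b * 4 powr \<delta> / a * measure \<mu> (cball x (r / 4)))"
    proof (rule sum_mono)
      fix x assume "x \<in> F"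
      then have x: "x \<in> \<Omega>" using F(2) by auto
      have "measure \<mu> (cball x r) \<le> b * r powr \<delta>"
        using upper[OF x, of r] r by simp
      also have "\<dots> = b * 4 powr \<delta> / a * (a * (r / 4) powr \<delta>)"
        using a r(1) by (simp add: powr_divide)
      also have "\<dots> \<le> b * 4 powr \<delta> / a * measure \<mu> (cball x (r / 4))"
        using lower[OF x, of "r / 4"] r a b by (intro mult_left_mono) auto
      finally show "measure \<mu> (cball x r) \<le> b * 4 powr \<delta> / a * measure \<mu> (cball x (r / 4))" .
    qed
    also have "\<dots> = b * 4 powr \<delta> / a * measure \<mu> (\<Union>x\<in>F. cball x (r / 4))"
      using F(1) cb by (subst finite_measure_finite_Union[OF F(1) _ disj]) (auto simp: sum_distrib_left)
    also have "\<dots> \<le> C"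
      unfolding C_def using a b by (intro mult_left_mono bounded_measure) auto
    finally show ?thesis
      using F by (intro exI[of _ F]) simp
  qed
  moreover have "0 \<le> C" using a b by (simp add: C_def)
  moreover have "0 < min r0 (sin 1)" using r0 sin1 by simp
  ultimately show thesis by (intro that)
qed

text \<open>A rational point within \<epsilon> of a point of a covering ball lies in the ball of
  twice the radius, since \<epsilon> is at most \<rho>; this is why \<open>small\<close> uses
  \<open>2 * \<rho>\<close>. There all points of height at most \<open>H\<close> share a hyperplane,
  so the part of the set in each ball is controlled by decay with factor \<open>D\<close>, and
  summing over the cover gives \<open>D * C\<close>.\<close>

lemma measure_near_rat_points_le:
  fixes \<Omega> :: "('n::finite) proj set"
  assumes fm: "finite_measure \<mu>" and sets: "sets \<mu> = sets borel"
    and F: "finite F" "\<Omega> \<subseteq> (\<Union>x\<in>F. cball x \<rho>)" "(\<Sum>x\<in>F. measure \<mu> (cball x \<rho>)) \<le> C"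
    and decay: "\<And>P x. proj_hyperplane P \<Longrightarrow> x \<in> F \<Longrightarrow>
      emeasure \<mu> (cball x \<rho> \<inter> hyperplane_nbhd P \<epsilon>) \<le> ennreal D * emeasure \<mu> (cball x \<rho>)"
    and D: "0 \<le> D" and \<epsilon>: "\<epsilon> \<le> \<rho>" and \<rho>: "0 < \<rho>"
    and small: "fact CARD('n) * (real CARD('n) * real H) ^ CARD('n) * (2 * \<rho>) ^ (CARD('n) - 1) < 1"
  shows "measure \<mu> (\<Omega> \<inter> (\<Union>q\<in>{q \<in> rat_points. height q \<le> H}. ball q \<epsilon>)) \<le> D * C"
proof -
  interpret finite_measure \<mu> by (rule fm)
  let ?Q = "{q \<in> (rat_points :: 'n proj set). height q \<le> H}"
  have "\<forall>x. \<exists>P. proj_hyperplane P \<and> ?Q \<inter> cball x (2 * \<rho>) \<subseteq> P"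
    using rat_points_cball_subset_hyperplane[OF _ small] \<rho> by auto
  then obtain P where P: "\<And>x. proj_hyperplane (P x)" "\<And>x. ?Q \<inter> cball x (2 * \<rho>) \<subseteq> P x"
    by metis
  have "open (hyperplane_nbhd Q \<epsilon>)" for Q :: "'n proj set"
    unfolding hyperplane_nbhd_def by (intro open_Collect_less continuous_intros)
  then have meas: "cball x \<rho> \<inter> hyperplane_nbhd (P x) \<epsilon> \<in> sets \<mu>" for x
    unfolding sets by (intro sets.Int borel_open borel_closed[OF closed_cball])
  have "\<Omega> \<inter> (\<Union>q\<in>?Q. ball q \<epsilon>) \<subseteq> (\<Union>x\<in>F. cball x \<rho> \<inter> hyperplane_nbhd (P x) \<epsilon>)"
  proof
    fix y assume "y \<in> \<Omega> \<inter> (\<Union>q\<in>?Q. ball q \<epsilon>)"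
    then obtain q where y: "y \<in> \<Omega>" and q: "q \<in> ?Q" and yq: "dist y q < \<epsilon>"
      by (auto simp: dist_commute)
    obtain x where x: "x \<in> F" "dist x y \<le> \<rho>" using F(2) y by auto
    have "dist x q \<le> 2 * \<rho>"
      using dist_triangle[of x q y] x(2) yq \<epsilon> by linarith
    then have "q \<in> P x" using P(2)[of x] q by auto
    then have "infdist y (P x) < \<epsilon>"
      using infdist_le[of q "P x" y] yq by linarith
    with x show "y \<in> (\<Union>x\<in>F. cball x \<rho> \<inter> hyperplane_nbhd (P x) \<epsilon>)"
      by (auto simp: hyperplane_nbhd_def)
  qed
  then have "measure \<mu> (\<Omega> \<inter> (\<Union>q\<in>?Q. ball q \<epsilon>))
      \<le> measure \<mu> (\<Union>x\<in>F. cball x \<rho> \<inter> hyperplane_nbhd (P x) \<epsilon>)"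
    using F(1) meas by (intro finite_measure_mono sets.finite_UN) auto
  also have "\<dots> \<le> (\<Sum>x\<in>F. measure \<mu> (cball x \<rho> \<inter> hyperplane_nbhd (P x) \<epsilon>))"
    using F(1) meas by (intro finite_measure_subadditive_finite) auto
  also have "\<dots> \<le> (\<Sum>x\<in>F. D * measure \<mu> (cball x \<rho>))"
  proof (rule sum_mono)
    fix x assume "x \<in> F"
    then show "measure \<mu> (cball x \<rho> \<inter> hyperplane_nbhd (P x) \<epsilon>) \<le> D * measure \<mu> (cball x \<rho>)"
      using decay[OF P(1), of x x] D
      by (simp add: emeasure_eq_measure flip: ennreal_mult)
  qed
  also have "\<dots> \<le> D * C"
    unfolding sum_distrib_left[symmetric] by (rule mult_left_mono[OF F(3) D])
  finally show ?thesis .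
qed

section \<open>Dyadic blocks\<close>

text \<open>Cauchy condensation: the block of indices up to \<open>2 ^ Suc t\<close> dominates a
  multiple of the condensed term at its right endpoint, where the non-increasing \<psi> is smallest.
  The condensed series is thus compared after a shift by one.\<close>

lemma summable_dyadic:
  fixes \<psi> :: "nat \<Rightarrow> real"
  assumes pos: "\<And>m. 1 \<le> m \<Longrightarrow> 0 \<le> \<psi> m"
    and mono: "\<And>m n. 1 \<le> m \<Longrightarrow> m \<le> n \<Longrightarrow> \<psi> n \<le> \<psi> m"
    and \<eta>: "0 \<le> \<eta>"
    and summ: "summable (\<lambda>k. real (Suc k) powr (\<alpha> - 1) * \<psi> (Suc k) powr \<eta>)"
  shows "summable (\<lambda>t. real (2 ^ t) powr \<alpha> * \<psi> (2 ^ t) powr \<eta>)"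
proof -
  define f where "f k = real (Suc k) powr (\<alpha> - 1) * \<psi> (Suc k) powr \<eta>" for k
  define B where "B t = (\<Sum>k\<in>{2 ^ t..<2 ^ Suc t}. f k)" for t :: nat
  define g where "g t = real (2 ^ t) powr \<alpha> * \<psi> (2 ^ t) powr \<eta>" for t :: nat
  \<comment> \<open>On a block from M/2 to M the power with exponent \<alpha> - 1 is least at M/2 if
    \<alpha> is at least 1 and at M otherwise; \<open>c\<close> covers both cases.\<close>
  define c where "c = min 1 (2 powr (1 - \<alpha>))"
  have c: "0 < c" "c \<le> 1" "c \<le> 2 powr (1 - \<alpha>)" by (auto simp: c_def)
  have f0: "0 \<le> f k" for k by (simp add: f_def)
  have summf: "summable f" using summ by (simp add: f_def[abs_def])
  \<comment> \<open>The blocks start at index 1, so the term at 0 is left out; nonnegativity keeps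
    these sums below the full sum.\<close>
  have partial: "(\<Sum>t<T. B t) = (\<Sum>k\<in>{1..<2 ^ T}. f k)" for T
  proof (induction T)
    case (Suc T)
    have "(\<Sum>k\<in>{1..<2 ^ T}. f k) + B T = (\<Sum>k\<in>{1..<2 ^ Suc T}. f k)"
      unfolding B_def by (rule sum.atLeastLessThan_concat) auto
    with Suc show ?case by simp
  qed simp
  have summB: "summable B"
  proof (rule summableI_nonneg_bounded)
    show "0 \<le> B t" for t unfolding B_def by (intro sum_nonneg f0)
    show "(\<Sum>t<T. B t) \<le> suminf f" for T
      unfolding partial by (rule sum_le_suminf[OF summf]) (auto simp: f0)
  qed
  have le: "g (Suc t) \<le> 2 / c * B t" for t
  proof -
    define M where "M = real (2 ^ Suc t)"
    have M: "0 < M" by (simp add: M_def)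
    have "c * M powr (\<alpha> - 1) * \<psi> (2 ^ Suc t) powr \<eta> \<le> f k" if k: "k \<in> {2 ^ t..<2 ^ Suc t}" for k
    proof -
      have k1: "real (Suc k) \<le> M" and "2 ^ t \<le> k"
        using k by (auto simp: M_def simp del: of_nat_Suc power_Suc)
      then have "real (2 ^ t) \<le> real k" by (simp only: of_nat_le_iff)
      moreover have "M / 2 = real (2 ^ t)" by (simp add: M_def)
      ultimately have k2: "M / 2 \<le> real (Suc k)" unfolding of_nat_Suc by linarith
      have "c * M powr (\<alpha> - 1) \<le> real (Suc k) powr (\<alpha> - 1)"
      proof (cases "1 \<le> \<alpha>")
        case True
        have "c * M powr (\<alpha> - 1) \<le> 2 powr (1 - \<alpha>) * M powr (\<alpha> - 1)"
          using c by (intro mult_right_mono) auto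
        also have "\<dots> = (M / 2) powr (\<alpha> - 1)"
          using M by (simp add: powr_divide powr_diff)
        also have "\<dots> \<le> real (Suc k) powr (\<alpha> - 1)"
          using True M k2 by (intro powr_mono2) auto
        finally show ?thesis .
      next
        case False
        have "c * M powr (\<alpha> - 1) \<le> 1 * M powr (\<alpha> - 1)"
          using c by (intro mult_right_mono) auto
        also have "\<dots> \<le> real (Suc k) powr (\<alpha> - 1)"
          using False k1 by (simp del: of_nat_Suc) (intro powr_mono2', auto)
        finally show ?thesis .
      qed
      moreover have "\<psi> (2 ^ Suc t) powr \<eta> \<le> \<psi> (Suc k) powr \<eta>"
        using k by (intro powr_mono2 \<eta> pos mono) auto
      ultimately show ?thesis
        unfolding f_def using c(1) by (intro mult_mono) auto
    qed
    then have "(\<Sum>k\<in>{2 ^ t..<2 ^ Suc t :: nat}. c * M powr (\<alpha> - 1) * \<psi> (2 ^ Suc t) powr \<eta>) \<le> B t"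
      unfolding B_def by (rule sum_mono)
    then have block: "2 ^ t * (c * M powr (\<alpha> - 1) * \<psi> (2 ^ Suc t) powr \<eta>) \<le> B t"
      by simp
    \<comment> \<open>The block has M/2 terms; this factor raises the exponent from \<alpha> - 1 to
      \<alpha> at the cost of a factor 2.\<close>
    have half: "2 ^ t = M / 2" by (simp add: M_def)
    have "c / 2 * g (Suc t) = 2 ^ t * (c * M powr (\<alpha> - 1) * \<psi> (2 ^ Suc t) powr \<eta>)"
      unfolding g_def M_def[symmetric] half using M by (simp add: powr_diff)
    with block have "c / 2 * g (Suc t) \<le> B t"
      by (simp only:)
    then show ?thesis
      using c(1) by (simp add: field_simps)
  qed
  have "summable (\<lambda>t. g (Suc t))"
  proof (rule summable_comparison_test')
    show "summable (\<lambda>t. 2 / c * B t)" by (rule summable_mult[OF summB])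
    show "norm (g (Suc t)) \<le> 2 / c * B t" for t
      using le[of t] by (simp add: g_def)
  qed
  then have "summable g"
    by (rule summable_Suc_iff[THEN iffD1])
  then show ?thesis
    unfolding g_def[abs_def] .
qed

section \<open>The convergence theorem\<close>

theorem theorem11:
  fixes N :: nat
    and \<Omega> :: "('n::finite) proj set"
    and \<mu> :: "'n proj measure"
    and \<delta> \<eta> :: real
    and \<psi> :: "nat \<Rightarrow> real"
  assumes "N \<ge> 1" and "CARD('n) = N + 1"
    and "compact \<Omega>"
    and "locally_finite_borel_on \<Omega> \<mu>"
    and "\<delta> > 0" and "\<eta> > 0"
    and "ahlfors_regular \<Omega> \<mu> \<delta>"
    and "proj_abs_decaying \<Omega> \<mu> \<eta>"
    and "\<And>m. m \<ge> 1 \<Longrightarrow> \<psi> m > 0"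
    and "\<And>m n. 1 \<le> m \<Longrightarrow> m \<le> n \<Longrightarrow> \<psi> n \<le> \<psi> m"
    and "summable (\<lambda>k. real (Suc k) powr (real (N + 1) / real N * \<eta> - 1) * \<psi> (Suc k) powr \<eta>)"
  shows "AE x in \<mu>. x \<in> \<Omega> \<longrightarrow> finite {q \<in> rat_points. dist x q < \<psi> (height q)}"
proof -
  note N = assms(1) and card = assms(2) and \<eta> = assms(6) and pos = assms(9) and mono = assms(10)
  have sets: "sets \<mu> = sets borel"
    using assms(4) by (simp add: locally_finite_borel_on_def)
  have fm: "finite_measure \<mu>"
    by (rule finite_measure_on_compact[OF assms(4,3)])
  interpret finite_measure \<mu> by (rule fm)
  obtain r1 C where r1: "0 < r1" and C: "0 \<le> C" and cover: "\<And>r. 0 < r \<Longrightarrow> r < r1 \<Longrightarrow>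
      \<exists>F. finite F \<and> F \<subseteq> \<Omega> \<and> \<Omega> \<subseteq> (\<Union>x\<in>F. cball x r) \<and> (\<Sum>x\<in>F. measure \<mu> (cball x r)) \<le> C"
    by (rule ahlfors_regular_cover[OF assms(3) fm sets assms(7)]) (rule that; blast)
  obtain c r2 where c: "0 < c" and r2: "0 < r2"
    and decay: "\<And>P \<epsilon> x r. proj_hyperplane P \<Longrightarrow> 0 < \<epsilon> \<Longrightarrow> x \<in> \<Omega> \<Longrightarrow> 0 < r \<Longrightarrow> r < r2 \<Longrightarrow>
      r \<le> sin 1 \<Longrightarrow> emeasure \<mu> (cball x r \<inter> hyperplane_nbhd P \<epsilon>)
        \<le> ennreal (c * (\<epsilon> / r) powr \<eta>) * emeasure \<mu> (cball x r)"
    using assms(8) unfolding proj_abs_decaying_def by blast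
  define \<gamma> where "\<gamma> = real (N + 1) / real N"
  have \<gamma>: "0 < \<gamma>" using N by (simp add: \<gamma>_def)
  \<comment> \<open>\<open>m\<close> is what remains of the simplex condition at height
    \<open>2 ^ Suc t\<close> once the powers of \<open>2 ^ t\<close> cancel. The choice of \<kappa>
    gives \<open>m * (2 * \<kappa>)\<close> = 1/2 and \<open>2 * \<kappa>\<close> at most 1, so that
    \<open>(2 * \<kappa>) ^ N\<close> is at most \<open>2 * \<kappa>\<close>.\<close>
  define m :: real where "m = fact (N + 1) * (2 * real (N + 1)) ^ (N + 1)"
  have "1 * 1 \<le> m"
    unfolding m_def by (intro mult_mono fact_ge_1 one_le_power) auto
  then have m: "1 \<le> m" by simp
  define \<kappa> where "\<kappa> = 1 / (4 * m)"
  have \<kappa>: "0 < \<kappa>" using m by (simp add: \<kappa>_def)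
  \<comment> \<open>\<open>s t powr \<eta>\<close> is the condensed term. As \<psi> at
    \<open>2 ^ t\<close> divided by the radius \<open>\<rho> t\<close> equals
    \<open>s t / \<kappa>\<close>, the decay factor is a constant times this term.\<close>
  define s where "s t = real (2 ^ t) powr \<gamma> * \<psi> (2 ^ t)" for t :: nat
  define \<rho> where "\<rho> t = \<kappa> * real (2 ^ t) powr (- \<gamma>)" for t :: nat
  have \<rho>: "0 < \<rho> t" for t using \<kappa> by (simp add: \<rho>_def)
  have \<psi>pos: "0 < \<psi> (2 ^ t)" for t by (rule pos) simp
  have spos: "0 < s t" for t using \<psi>pos[of t] by (simp add: s_def)
  have ratio: "\<psi> (2 ^ t) / \<rho> t = s t / \<kappa>" for t
    using \<kappa> by (simp add: s_def \<rho>_def powr_minus field_simps)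
  have s\<eta>: "s t powr \<eta> = real (2 ^ t) powr (\<gamma> * \<eta>) * \<psi> (2 ^ t) powr \<eta>" for t
    using \<psi>pos[of t] by (simp add: s_def powr_mult powr_powr)
  have summ: "summable (\<lambda>t. s t powr \<eta>)"
    unfolding s\<eta> using assms(11) \<eta> mono less_imp_le[OF pos]
    by (intro summable_dyadic) (auto simp: \<gamma>_def)
  have "(\<lambda>t. s t powr \<eta>) \<longlonglongrightarrow> 0" by (rule summable_LIMSEQ_zero[OF summ])
  then have ev\<psi>: "\<forall>\<^sub>F t in sequentially. s t powr \<eta> < \<kappa> powr \<eta>"
    by (rule order_tendstoD) (use \<kappa> in simp)
  have "filterlim (\<lambda>t. 2 ^ t :: real) at_top sequentially"
    by (intro filterlim_at_infinity_imp_filterlim_at_top filterlim_realpow_sequentially_gt1) auto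
  then have "(\<lambda>t. (2 ^ t :: real) powr (- \<gamma>)) \<longlonglongrightarrow> 0"
    using \<gamma> by (intro tendsto_neg_powr) auto
  then have "\<rho> \<longlonglongrightarrow> \<kappa> * 0"
    unfolding \<rho>_def by (intro tendsto_mult tendsto_const) simp
  moreover have "0 < min (min r1 r2) (sin 1)"
    using r1 r2 pi_gt3 by (auto intro!: sin_gt_zero)
  ultimately have ev\<rho>: "\<forall>\<^sub>F t in sequentially. \<rho> t < min (min r1 r2) (sin 1)"
    by (intro order_tendstoD) auto
  \<comment> \<open>The exponent \<gamma> is chosen so that \<gamma> N = N + 1: the N-th power of
    the radius cancels the (N+1)-st power of the height exactly.\<close>
  have small: "fact CARD('n) * (real CARD('n) * real (2 ^ Suc t)) ^ CARD('n)
      * (2 * \<rho> t) ^ (CARD('n) - 1) < 1" for t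
  proof -
    have "(real (2 ^ t) powr (- \<gamma>)) ^ N = real (2 ^ t) powr (- real (N + 1))"
      using N by (simp add: powr_power \<gamma>_def)
    also have "\<dots> = inverse (real (2 ^ t) ^ (N + 1))"
      by (subst powr_minus, subst powr_realpow) auto
    finally have "(2 * \<rho> t) ^ N = (2 * \<kappa>) ^ N * inverse (real (2 ^ t) ^ (N + 1))"
      by (simp add: \<rho>_def power_mult_distrib)
    moreover have "(real (N + 1) * real (2 ^ Suc t)) ^ (N + 1)
        = (2 * real (N + 1)) ^ (N + 1) * real (2 ^ t) ^ (N + 1)"
    proof -
      have "real (N + 1) * real (2 ^ Suc t) = 2 * real (N + 1) * real (2 ^ t)" by simp
      then show ?thesis by (simp only: power_mult_distrib)
    qed
    ultimately have "fact CARD('n) * (real CARD('n) * real (2 ^ Suc t)) ^ CARD('n)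
        * (2 * \<rho> t) ^ (CARD('n) - 1) = m * (2 * \<kappa>) ^ N"
      by (simp add: card m_def del: fact_Suc power_Suc of_nat_add of_nat_Suc)
    also have "\<dots> \<le> m * (2 * \<kappa>)"
    proof (rule mult_left_mono)
      have "2 * \<kappa> \<le> 1" using m by (simp add: \<kappa>_def divide_simps)
      then show "(2 * \<kappa>) ^ N \<le> 2 * \<kappa>"
        using N \<kappa> power_decreasing[of 1 N "2 * \<kappa>"] by simp
    qed (use m in simp)
    also have "\<dots> < 1" using m by (simp add: \<kappa>_def)
    finally show ?thesis .
  qed
  \<comment> \<open>All heights up to \<open>2 ^ Suc t\<close> are kept, not just the dyadic block,
    since the simplex lemma needs only an upper bound. On the block, monotonicity bounds \<psi> of
    the height by its value at \<open>2 ^ t\<close>.\<close>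
  define Q where "Q t = {q \<in> (rat_points :: 'n proj set). height q \<le> 2 ^ Suc t}" for t :: nat
  define A where "A t = \<Omega> \<inter> (\<Union>q\<in>Q t. ball q (\<psi> (2 ^ t)))" for t
  have "A t \<in> sets borel" for t
    unfolding A_def using compact_imp_closed[OF assms(3)] by (intro sets.Int borel_open borel_closed) auto
  then have Am: "A t \<in> sets \<mu>" for t by (simp add: sets)
  have evA: "\<forall>\<^sub>F t in sequentially. norm (measure \<mu> (A t)) \<le> c * (1 / \<kappa>) powr \<eta> * C * s t powr \<eta>"
    using ev\<psi> ev\<rho>
  proof eventually_elim
    case (elim t)
    have "s t < \<kappa>"
      using elim(1) powr_mono2[of \<eta> \<kappa> "s t"] \<eta> \<kappa> by force
    then have "\<psi> (2 ^ t) / \<rho> t \<le> 1" unfolding ratio using \<kappa> by simp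
    then have \<psi>\<rho>: "\<psi> (2 ^ t) \<le> \<rho> t" using \<rho>[of t] by simp
    obtain F where F: "finite F" "F \<subseteq> \<Omega>" "\<Omega> \<subseteq> (\<Union>x\<in>F. cball x (\<rho> t))"
      "(\<Sum>x\<in>F. measure \<mu> (cball x (\<rho> t))) \<le> C"
      using cover[OF \<rho>, of t] elim(2) by auto
    have "measure \<mu> (A t) \<le> (c * (\<psi> (2 ^ t) / \<rho> t) powr \<eta>) * C"
      unfolding A_def Q_def
    proof (rule measure_near_rat_points_le[OF fm sets F(1,3,4) _ _ \<psi>\<rho> \<rho> small])
      fix P :: "'n proj set" and x assume "proj_hyperplane P" "x \<in> F"
      then show "emeasure \<mu> (cball x (\<rho> t) \<inter> hyperplane_nbhd P (\<psi> (2 ^ t)))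
          \<le> ennreal (c * (\<psi> (2 ^ t) / \<rho> t) powr \<eta>) * emeasure \<mu> (cball x (\<rho> t))"
        using F(2) \<rho>[of t] \<psi>pos[of t] elim(2) by (intro decay) auto
    qed (use c in simp)
    also have "(\<psi> (2 ^ t) / \<rho> t) powr \<eta> = (1 / \<kappa>) powr \<eta> * s t powr \<eta>"
      unfolding ratio using \<kappa> spos[of t] by (simp add: powr_divide)
    finally show ?case by (simp add: mult_ac)
  qed
  have "summable (\<lambda>t. measure \<mu> (A t))"
    by (rule summable_comparison_test_ev[OF evA summable_mult[OF summ]])
  then have "AE x in \<mu>. \<forall>\<^sub>F t in sequentially. x \<in> space \<mu> - A t"
    by (intro borel_cantelli_AE1 Am) (simp_all add: emeasure_eq_measure)
  then show ?thesis
  proof eventually_elim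
    case (elim x)
    then obtain T where T: "\<And>t. T \<le> t \<Longrightarrow> x \<notin> A t"
      by (auto simp: eventually_sequentially)
    show ?case
    proof
      assume x: "x \<in> \<Omega>"
      \<comment> \<open>A solution of height above \<open>2 ^ T\<close> has its height in a block
        with \<open>2 ^ T < 2 ^ Suc t\<close>, hence \<open>T \<le> t\<close>, and would put
        \<open>x\<close> in \<open>A t\<close>. Only the finitely many points of height at most
        \<open>2 ^ T\<close> remain.\<close>
      have "{q \<in> rat_points. dist x q < \<psi> (height q)} \<subseteq> {q \<in> rat_points. height q \<le> 2 ^ T}"
      proof (rule subsetI, rule ccontr)
        fix q assume "q \<in> {q \<in> rat_points. dist x q < \<psi> (height q)}"
          and "q \<notin> {q \<in> rat_points. height q \<le> 2 ^ T}"
        then have q: "q \<in> rat_points" "dist x q < \<psi> (height q)" "2 ^ T < height q" by auto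
        obtain t where t: "2 ^ t \<le> height q" "height q < 2 ^ Suc t"
          using ex_power_ivl1[of 2 "height q"] height_pos[OF q(1)] by auto
        have "(2::nat) ^ T < 2 ^ Suc t" using q(3) t(2) by linarith
        then have "T \<le> t" by (simp add: power_strict_increasing_iff del: power_Suc)
        have "\<psi> (height q) \<le> \<psi> (2 ^ t)" using t(1) by (intro mono) auto
        then have "x \<in> A t"
          using x q t by (auto simp: A_def Q_def dist_commute)
        with T[OF \<open>T \<le> t\<close>] show False by simp
      qed
      then show "finite {q \<in> rat_points. dist x q < \<psi> (height q)}"
        by (rule finite_subset) (rule finite_rat_points_height_le)
    qed
  qed
qed

end
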